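(* Let $k$ be a field of characteristic $p>0$, $\mathcal{G}$ a finite group scheme over $k$, $\mathcal{N}\subseteq\mathcal{G}$ a normal subgroup scheme such that $\mathcal{G}/\mathcal{N}$ is infinitesimal, and $Z$ an $\mathcal{N}$-module. Let $I$ be the augmentation ideal of $k[\mathcal{G}]^{\mathcal{N}}$ and let $0=N_{-1}\subseteq N_0\subseteq\dots\subseteq N_n=k\mathcal{G}\otimes_{k\mathcal{N}}Z$ be the associated filtration by $\mathcal{N}$-modules. Assume that (i) $I$ is a principal ideal, (ii) $\dim_k\operatorname{Ext}^1_{\mathcal{N}}(Z,Z)=1$, and (iii) the $\mathcal{G}$-module $k\mathcal{G}\otimes_{k\mathcal{N}}Z$ is a brick. Then for all $l\in\{1,\dots,n\}$ the short exact sequence of $\mathcal{N}$-modules $$0\to N_{l-1}\to N_l\to Z\to 0$$ does not split.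
   Context: All modules are finite-dimensional over $k$. $k[\mathcal{G}]$ is the coordinate ring, $k\mathcal{G}:=k[\mathcal{G}]^*$ the group algebra. $\mathcal{G}/\mathcal{N}$ infinitesimal means $k[\mathcal{G}/\mathcal{N}]\cong k[\mathcal{G}]^{\mathcal{N}}$ is local. For a $k$-algebra $A$, an $A$-module $M$ is a brick if $\operatorname{End}_A(M)\cong k$. Filtration: let $J=\ker(k[\mathcal{G}]\to k[\mathcal{N}])$ and $I:=k[\mathcal{G}]^{\mathcal{N}}\cap J$, the augmentation ideal of $k[\mathcal{G}]^{\mathcal{N}}$; $J=Ik[\mathcal{G}]$ is nilpotent. Put $H_l:=\{v\in k\mathcal{G}\mid v(J^{l+1})=0\}$, giving a filtration $0=H_{-1}\subseteq k\mathcal{N}=H_0\subseteq\dots\subseteq H_n=k\mathcal{G}$ by $(k\mathcal{N},k\mathcal{N})$-bimodules ($n$ minimal with $J^{n+1}=0$). The canonical maps $H_l\otimes_{k\mathcal{N}}Z\to k\mathcal{G}\otimes_{k\mathcal{N}}Z$ are injective, and $N_l$ denotes the image, an $\mathcal{N}$-submodule; $N_0\cong Z$. In the short exact sequence the first map is the inclusion and the second is the canonical projection $N_l\to N_l/N_{l-1}$ followed by an isomorphism $N_l/N_{l-1}\cong Z$, which exists when $I$ is principal. (Explicitly: if $I=(f)$, it is the restriction to $N_l$ of the endomorphism of $k\mathcal{G}\otimes_{k\mathcal{N}}Z$ given by $h\otimes z\mapsto (f^{l}.h)\otimes z$, whose image is $N_0\cong Z$; here $(x.h)(y)=h(yx)$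 for $x\in k[\mathcal{G}]^{\mathcal{N}}$, $h\in k\mathcal{G}$, $y\in k[\mathcal{G}]$.) *)

theory Defs
  imports Complex_Main "HOL-Algebra.Ideal_Product" "HOL-Library.Function_Algebras"
begin

section \<open>Subspaces, algebras, modules\<close>

text \<open>
  Vector spaces are subspaces \<open>elems\<close> of an ambient type carrying a vector space structure, whose
  addition is the one of the type class and whose scalar multiplication is \<open>smul\<close>. Function
  types carry the pointwise addition of \<^theory>\<open>HOL-Library.Function_Algebras\<close>.
\<close>

record ('k, 'm) space =
  elems :: "'m set"
  smul :: "'k \<Rightarrow> 'm \<Rightarrow> 'm"

record ('k, 'r) alg = "('k, 'r) space" +
  prd :: "'r \<Rightarrow> 'r \<Rightarrow> 'r"
  unt :: 'r

record ('k, 'r, 'm) lmod = "('k, 'm) space" +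
  act :: "'r \<Rightarrow> 'm \<Rightarrow> 'm"

definition is_space :: "('k::field, 'm::ab_group_add, 'x) space_scheme \<Rightarrow> bool" where
  "is_space V \<longleftrightarrow> vector_space (smul V) \<and> module.subspace (smul V) (elems V)"

definition fin_dim :: "('k::field, 'm::ab_group_add, 'x) space_scheme \<Rightarrow> bool" where
  "fin_dim V \<longleftrightarrow> (\<exists>B. finite B \<and> elems V = module.span (smul V) B)"

definition linmap :: "('k::field, 'm::ab_group_add, 'x) space_scheme
    \<Rightarrow> ('k, 'n::ab_group_add, 'y) space_scheme \<Rightarrow> ('m \<Rightarrow> 'n) \<Rightarrow> bool" where
  "linmap V W f \<longleftrightarrow> (\<forall>x\<in>elems V. f x \<in> elems W)
     \<and> (\<forall>x\<in>elems V. \<forall>y\<in>elems V. f (x + y) = f x + f y)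
     \<and> (\<forall>c. \<forall>x\<in>elems V. f (smul V c x) = smul W c (f x))"

definition base :: "('k::field, 'k) space" where
  "base = \<lparr>elems = UNIV, smul = (*)\<rparr>"

definition fscale :: "'k::field \<Rightarrow> ('x \<Rightarrow> 'k) \<Rightarrow> ('x \<Rightarrow> 'k)" where
  "fscale c u = (\<lambda>x. c * u x)"

definition is_module ::
  "('k::field, 'r::ab_group_add) alg \<Rightarrow> ('k, 'r, 'm::ab_group_add) lmod \<Rightarrow> bool" where
  "is_module R M \<longleftrightarrow> is_space M
     \<and> (\<forall>r\<in>elems R. linmap M M (act M r))
     \<and> (\<forall>x\<in>elems M. linmap R M (\<lambda>r. act M r x))
     \<and> (\<forall>r\<in>elems R. \<forall>s\<in>elems R. \<forall>x\<in>elems M. act M (prd R r s) x = act M r (act M s x))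
     \<and> (\<forall>x\<in>elems M. act M (unt R) x = x)"

definition is_hom :: "('k::field, 'r::ab_group_add) alg \<Rightarrow> ('k, 'r, 'm::ab_group_add) lmod
    \<Rightarrow> ('k, 'r, 'n::ab_group_add) lmod \<Rightarrow> ('m \<Rightarrow> 'n) \<Rightarrow> bool" where
  "is_hom R M N f \<longleftrightarrow> linmap M N f
     \<and> (\<forall>r\<in>elems R. \<forall>x\<in>elems M. f (act M r x) = act N r (f x))"

text \<open>Elements of \<open>Hom\<close> are normalised to be 0 off \<open>elems M\<close>, so that equality of functions is equality
  of homomorphisms and \<open>Hom\<close> is a space under the pointwise operations.\<close>

definition Hom :: "('k::field, 'r::ab_group_add) alg \<Rightarrow> ('k, 'r, 'm::ab_group_add) lmod
    \<Rightarrow> ('k, 'r, 'n::ab_group_add) lmod \<Rightarrow> ('m \<Rightarrow> 'n) set" where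
  "Hom R M N = {f. is_hom R M N f \<and> (\<forall>x. x \<notin> elems M \<longrightarrow> f x = 0)}"

text \<open>A brick: there is an isomorphism of \<open>k\<close>-algebras from \<open>k\<close> to the endomorphism algebra.\<close>

definition brick :: "('k::field, 'r::ab_group_add) alg
    \<Rightarrow> ('k, 'r, 'm::ab_group_add) lmod \<Rightarrow> bool" where
  "brick R M \<longleftrightarrow> (\<exists>\<phi>. bij_betw \<phi> UNIV (Hom R M M)
     \<and> (\<forall>c d. \<phi> (c + d) = \<phi> c + \<phi> d)
     \<and> (\<forall>c d. \<phi> (c * d) = \<phi> c \<circ> \<phi> d)
     \<and> (\<forall>c d. \<phi> (c * d) = (\<lambda>x. smul M c (\<phi> d x)))
     \<and> (\<forall>x\<in>elems M. \<phi> 1 x = x))"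

definition short_exact :: "('k::field, 'r::ab_group_add) alg \<Rightarrow> ('k, 'r, 'l::ab_group_add) lmod
    \<Rightarrow> ('k, 'r, 'm::ab_group_add) lmod \<Rightarrow> ('k, 'r, 'n::ab_group_add) lmod
    \<Rightarrow> ('l \<Rightarrow> 'm) \<Rightarrow> ('m \<Rightarrow> 'n) \<Rightarrow> bool" where
  "short_exact R X Y W i p \<longleftrightarrow> is_hom R X Y i \<and> is_hom R Y W p
     \<and> inj_on i (elems X) \<and> p ` elems Y = elems W
     \<and> i ` elems X = {y \<in> elems Y. p y = 0}"

definition splits :: "('k::field, 'r::ab_group_add) alg \<Rightarrow> ('k, 'r, 'm::ab_group_add) lmod
    \<Rightarrow> ('k, 'r, 'n::ab_group_add) lmod \<Rightarrow> ('m \<Rightarrow> 'n) \<Rightarrow> bool" where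
  "splits R Y W p \<longleftrightarrow> (\<exists>s. is_hom R W Y s \<and> (\<forall>w\<in>elems W. p (s w) = w))"


section \<open>The first Ext group\<close>

definition free_mod :: "('k::field, 'r::ab_group_add) alg \<Rightarrow> nat \<Rightarrow> ('k, 'r, nat \<Rightarrow> 'r) lmod" where
  "free_mod R m = \<lparr>elems = {v. (\<forall>i<m. v i \<in> elems R) \<and> (\<forall>i\<ge>m. v i = 0)},
     smul = (\<lambda>c v i. smul R c (v i)), act = (\<lambda>r v i. prd R r (v i))\<rparr>"

text \<open>The beginning \<open>R\<^sup>c \<rightarrow> R\<^sup>b \<rightarrow> R\<^sup>a \<rightarrow> M \<rightarrow> 0\<close> of a resolution by free modules of finite rank.\<close>

definition free_resolution :: "('k::field, 'r::ab_group_add) alg \<Rightarrow> ('k, 'r, 'm::ab_group_add) lmod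
    \<Rightarrow> nat \<times> nat \<times> nat \<times> ((nat \<Rightarrow> 'r) \<Rightarrow> 'm) \<times> ((nat \<Rightarrow> 'r) \<Rightarrow> (nat \<Rightarrow> 'r)) \<times> ((nat \<Rightarrow> 'r) \<Rightarrow> (nat \<Rightarrow> 'r))
    \<Rightarrow> bool" where
  "free_resolution R M = (\<lambda>(a, b, c, e, d1, d2).
     e \<in> Hom R (free_mod R a) M
     \<and> d1 \<in> Hom R (free_mod R b) (free_mod R a)
     \<and> d2 \<in> Hom R (free_mod R c) (free_mod R b)
     \<and> e ` elems (free_mod R a) = elems M
     \<and> d1 ` elems (free_mod R b) = {x \<in> elems (free_mod R a). e x = 0}
     \<and> d2 ` elems (free_mod R c) = {x \<in> elems (free_mod R b). d1 x = 0})"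

text \<open>\<open>dim Ext\<^sup>1(M, N)\<close>: the dimension of the first cohomology of \<open>Hom(P, N)\<close>, for a chosen
  free resolution \<open>P\<close> of the finite-dimensional module \<open>M\<close> over the finite-dimensional algebra \<open>R\<close>.\<close>

definition ext1_dim :: "('k::field, 'r::ab_group_add) alg \<Rightarrow> ('k, 'r, 'm::ab_group_add) lmod
    \<Rightarrow> ('k, 'r, 'n::ab_group_add) lmod \<Rightarrow> nat" where
  "ext1_dim R M N =
     (let (a, b, c, e, d1, d2) = (SOME P. free_resolution R M P);
          dm = vector_space.dim (\<lambda>c u x. smul N c (u x));
          cocycles = {u \<in> Hom R (free_mod R b) N. \<forall>x\<in>elems (free_mod R c). u (d2 x) = 0};
          coboundaries = {u \<circ> d1 |u. u \<in> Hom R (free_mod R a) N}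
      in dm cocycles - dm coboundaries)"


section \<open>Tensor products\<close>

text \<open>
  Data of a tensor product \<open>M \<otimes>\<^sub>R N\<close> of a right \<open>R\<close>-module and a left \<open>R\<close>-module, \<open>R\<close> being a
  \<open>k\<close>-algebra. As model we take the span of the evaluations at pairs \<open>(m, n)\<close> inside the dual of the
  space of \<open>R\<close>-balanced \<open>k\<close>-bilinear forms on \<open>M \<times> N\<close>; forms separate the points of the usual
  quotient construction because \<open>k\<close> is a field. That this is a tensor product (universal
  property for maps into arbitrary spaces) is lemma \<open>tensor_universal\<close>.
\<close>

record ('k, 'm, 'r, 'n) tdata =
  lft :: "('k, 'm) space"
  rgt :: "('k, 'n) space"
  mid :: "'r set"
  ract :: "'m \<Rightarrow> 'r \<Rightarrow> 'm"
  lact :: "'r \<Rightarrow> 'n \<Rightarrow> 'n"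

type_synonym ('m, 'n, 'k) tensor = "('m \<Rightarrow> 'n \<Rightarrow> 'k) \<Rightarrow> 'k"

definition balanced :: "('k::field, 'm::ab_group_add, 'r, 'n::ab_group_add) tdata
    \<Rightarrow> ('k, 'w::ab_group_add) space \<Rightarrow> ('m \<Rightarrow> 'n \<Rightarrow> 'w) \<Rightarrow> bool" where
  "balanced D W b \<longleftrightarrow>
     (\<forall>x\<in>elems (lft D). linmap (rgt D) W (b x))
     \<and> (\<forall>y\<in>elems (rgt D). linmap (lft D) W (\<lambda>x. b x y))
     \<and> (\<forall>x\<in>elems (lft D). \<forall>r\<in>mid D. \<forall>y\<in>elems (rgt D). b (ract D x r) y = b x (lact D r y))"

definition tens :: "('k::field, 'm::ab_group_add, 'r, 'n::ab_group_add) tdata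
    \<Rightarrow> 'm \<Rightarrow> 'n \<Rightarrow> ('m, 'n, 'k) tensor" where
  "tens D x y = (\<lambda>\<beta>. if balanced D base \<beta> then \<beta> x y else 0)"

definition tspace :: "('k::field, 'm::ab_group_add, 'r, 'n::ab_group_add) tdata
    \<Rightarrow> ('k, ('m, 'n, 'k) tensor) space" where
  "tspace D = \<lparr>elems = module.span fscale {tens D x y |x y. x \<in> elems (lft D) \<and> y \<in> elems (rgt D)},
     smul = fscale\<rparr>"

text \<open>The linear map \<open>M \<otimes>\<^sub>R N \<rightarrow> W\<close> induced by a balanced map, \<open>x \<otimes> y \<mapsto> b x y\<close>.\<close>

definition tlift :: "('k::field, 'm::ab_group_add, 'r, 'n::ab_group_add) tdata
    \<Rightarrow> ('k, 'w::ab_group_add) space \<Rightarrow> ('m \<Rightarrow> 'n \<Rightarrow> 'w) \<Rightarrow> ('m, 'n, 'k) tensor \<Rightarrow> 'w" where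
  "tlift D W b t = (THE w. \<exists>L. linmap (tspace D) W L
     \<and> (\<forall>x\<in>elems (lft D). \<forall>y\<in>elems (rgt D). L (tens D x y) = b x y) \<and> w = L t)"

definition over_k :: "('k::field, 'm::ab_group_add) space \<Rightarrow> ('k, 'n::ab_group_add) space
    \<Rightarrow> ('k, 'm, 'k, 'n) tdata" where
  "over_k V W = \<lparr>lft = V, rgt = W, mid = UNIV, ract = (\<lambda>x c. smul V c x), lact = smul W\<rparr>"

lemma vector_space_fscale: "vector_space (fscale :: 'k::field \<Rightarrow> ('x \<Rightarrow> 'k) \<Rightarrow> _)"
  by unfold_locales (auto simp: fscale_def fun_eq_iff algebra_simps)

lemma separating_functional:
  fixes s :: "'k::field \<Rightarrow> 'w::ab_group_add \<Rightarrow> 'w"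
  assumes "vector_space s" "w \<noteq> 0"
  shows "\<exists>\<alpha>. (\<forall>x y. \<alpha> (x + y) = \<alpha> x + \<alpha> y) \<and> (\<forall>c x. \<alpha> (s c x) = c * \<alpha> x) \<and> \<alpha> w = (1::'k)"
proof -
  interpret vector_space s by fact
  have ind: "independent {w}" using assms(2) by simp
  define B where "B = extend_basis {w}"
  have B: "independent B" "span B = UNIV" "w \<in> B"
    using ind extend_basis_superset[OF ind] by (auto simp: B_def independent_extend_basis)
  show ?thesis
  proof (intro exI conjI allI)
    show "representation B (x + y) w = representation B x w + representation B y w" for x y
      using B by (simp add: representation_add)
    show "representation B (s c x) w = c * representation B x w" for c x
      using B by (simp add: representation_scale)
    show "representation B w w = 1"
      using B by (simp add: representation_basis)
  qed
qed

lemma tlift_unique_aux: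
  assumes L: "linmap (tspace D) W L" and L': "linmap (tspace D) W L'"
    and W: "is_space W"
    and eq: "\<And>x y. x \<in> elems (lft D) \<Longrightarrow> y \<in> elems (rgt D) \<Longrightarrow> L (tens D x y) = L' (tens D x y)"
    and t: "t \<in> elems (tspace D)"
  shows "L t = L' t"
proof -
  interpret F: vector_space fscale by (rule vector_space_fscale)
  interpret V: vector_space "smul W" using W by (simp add: is_space_def)
  let ?S = "{tens D x y |x y. x \<in> elems (lft D) \<and> y \<in> elems (rgt D)}"
  have zero: "K 0 = 0" if "linmap (tspace D) W K" for K
  proof -
    have "0 \<in> elems (tspace D)" by (simp add: tspace_def F.span_zero)
    then have "K (0 + 0) = K 0 + K 0" using that unfolding linmap_def by blast
    then show ?thesis by simp
  qed
  have Ladd: "L (u + v) = L u + L v" "L' (u + v) = L' u + L' v"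
    and Lscale: "L (fscale c u) = smul W c (L u)" "L' (fscale c u) = smul W c (L' u)"
    if "u \<in> F.span ?S" "v \<in> F.span ?S" for c u v
    using L L' that by (simp_all add: linmap_def tspace_def)
  define E where "E = {u \<in> F.span ?S. L u = L' u}"
  have "F.subspace E"
    unfolding F.subspace_def
  proof (intro conjI ballI allI)
    show "0 \<in> E" unfolding E_def using zero[OF L] zero[OF L'] F.span_zero by (metis (mono_tags, lifting) mem_Collect_eq)
    fix u assume u: "u \<in> E"
    then have us: "u \<in> F.span ?S" "L u = L' u" unfolding E_def by blast+
    show "fscale c u \<in> E" for c
      unfolding E_def using F.span_scale[OF us(1)] Lscale[OF us(1) us(1)] us(2) by simp
    fix v assume v: "v \<in> E"
    then have vs: "v \<in> F.span ?S" "L v = L' v" unfolding E_def by blast+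
    show "u + v \<in> E"
      unfolding E_def using F.span_add[OF us(1) vs(1)] Ladd[OF us(1) vs(1)] us(2) vs(2) by simp
  qed
  moreover have "?S \<subseteq> E"
  proof
    fix u assume u: "u \<in> ?S"
    then have "L u = L' u" using eq by blast
    then show "u \<in> E" unfolding E_def using F.span_base[OF u] by blast
  qed
  ultimately have "F.span ?S \<subseteq> E" using F.span_minimal by blast
  then show ?thesis using t unfolding E_def by (auto simp: tspace_def)
qed

lemma tensor_universal:
  fixes D :: "('k::field, 'm::ab_group_add, 'r, 'n::ab_group_add) tdata"
    and W :: "('k, 'w::ab_group_add) space"
  assumes b: "balanced D W b" and W: "is_space W"
  shows "linmap (tspace D) W (tlift D W b)"
    and "x \<in> elems (lft D) \<Longrightarrow> y \<in> elems (rgt D) \<Longrightarrow> tlift D W b (tens D x y) = b x y"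
proof -
  interpret F: vector_space fscale by (rule vector_space_fscale)
  interpret V: vector_space "smul W" using W by (simp add: is_space_def)
  have sub: "V.subspace (elems W)" using W by (simp add: is_space_def)
  let ?S = "{tens D x y |x y. x \<in> elems (lft D) \<and> y \<in> elems (rgt D)}"
  define dl where "dl = {\<alpha>::'w \<Rightarrow> 'k. (\<forall>x y. \<alpha> (x + y) = \<alpha> x + \<alpha> y)
                              \<and> (\<forall>c x. \<alpha> (smul W c x) = c * \<alpha> x)}"
  define P where "P t w \<longleftrightarrow> w \<in> elems W \<and> (\<forall>\<alpha>\<in>dl. \<alpha> w = t (\<lambda>x y. \<alpha> (b x y)))" for t w
  have form: "balanced D base (\<lambda>x y. \<alpha> (b x y))" if "\<alpha> \<in> dl" for \<alpha>
    using b that by (auto simp: balanced_def linmap_def base_def dl_def)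
  have uniq: "w = w'" if "P t w" "P t w'" for t w w'
  proof (rule ccontr)
    assume "w \<noteq> w'"
    then obtain \<alpha> where \<alpha>: "\<forall>x y. \<alpha> (x + y) = \<alpha> x + \<alpha> y" "\<forall>c x. \<alpha> (smul W c x) = c * \<alpha> x"
        "\<alpha> (w - w') = (1::'k)"
      using separating_functional[OF V.vector_space_axioms, of "w - w'"] by auto
    have "\<alpha> \<in> dl" using \<alpha> by (simp add: dl_def)
    then have "\<alpha> w = \<alpha> w'" using that unfolding P_def by metis
    moreover have "\<alpha> w = \<alpha> w' + \<alpha> (w - w')"
      using \<alpha>(1)[rule_format, of w' "w - w'"] by simp
    ultimately show False using \<alpha>(3) by simp
  qed
  have elem: "P (tens D x y) (b x y)" if "x \<in> elems (lft D)" "y \<in> elems (rgt D)" for x y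
    using that form b by (auto simp: P_def tens_def balanced_def linmap_def)
  have add: "P (t + t') (w + w')" if "P t w" "P t' w'" for t t' w w'
    using that sub by (auto simp: P_def dl_def V.subspace_add)
  have scale: "P (fscale c t) (smul W c w)" if "P t w" for t w c
    using that sub by (auto simp: P_def dl_def V.subspace_scale fscale_def)
  have zero: "P 0 0"
  proof -
    have "\<alpha> 0 = 0" if "\<alpha> \<in> dl" for \<alpha>
    proof -
      have "\<alpha> (0 + 0) = \<alpha> 0 + \<alpha> 0" using that unfolding dl_def by blast
      then show ?thesis by (metis add.right_neutral add_left_cancel)
    qed
    then show ?thesis using sub by (simp add: P_def V.subspace_0)
  qed
  have ex: "\<exists>w. P t w" if "t \<in> F.span ?S" for t
    using that
  proof (induction rule: F.span_induct_alt)
    case base then show ?case using zero by blast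
  next
    case (step c x y)
    then show ?case using elem add scale by blast
  qed
  define L where "L t = (THE w. P t w)" for t
  have LP: "P t (L t)" if "t \<in> F.span ?S" for t
    unfolding L_def using ex[OF that] uniq by (metis theI)
  have LI: "L t = w" if "P t w" for t w
    unfolding L_def using that uniq by blast
  have lin: "linmap (tspace D) W L"
    unfolding linmap_def
  proof (intro conjI ballI allI)
    fix t assume t: "t \<in> elems (tspace D)"
    then show "L t \<in> elems W" using LP by (simp add: tspace_def P_def)
    show "L (smul (tspace D) c t) = smul W c (L t)" for c
      using LI scale LP t by (simp add: tspace_def)
    fix t' assume "t' \<in> elems (tspace D)"
    then show "L (t + t') = L t + L t'"
      using LI add LP t by (simp add: tspace_def)
  qed
  have Lt: "L (tens D x y) = b x y" if "x \<in> elems (lft D)" "y \<in> elems (rgt D)" for x y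
    using LI elem that by blast
  have eq: "tlift D W b t = L t" if "t \<in> elems (tspace D)" for t
    unfolding tlift_def
  proof (rule the_equality)
    fix w assume "\<exists>K. linmap (tspace D) W K
        \<and> (\<forall>x\<in>elems (lft D). \<forall>y\<in>elems (rgt D). K (tens D x y) = b x y) \<and> w = K t"
    then obtain K where K: "linmap (tspace D) W K" "w = K t"
      "\<And>x y. x \<in> elems (lft D) \<Longrightarrow> y \<in> elems (rgt D) \<Longrightarrow> K (tens D x y) = b x y" by blast
    show "w = L t" unfolding K(2) by (rule tlift_unique_aux[OF K(1) lin W _ that]) (simp add: K Lt)
  qed (use lin Lt in blast)
  have closed: "smul (tspace D) c t \<in> elems (tspace D)" "t + t' \<in> elems (tspace D)"
    if "t \<in> elems (tspace D)" "t' \<in> elems (tspace D)" for c t t'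
    using that by (auto simp: tspace_def F.span_add F.span_scale)
  show "linmap (tspace D) W (tlift D W b)"
    unfolding linmap_def
  proof (intro conjI ballI allI)
    fix t assume t: "t \<in> elems (tspace D)"
    show "tlift D W b t \<in> elems W" using lin eq t by (simp add: linmap_def)
    show "tlift D W b (smul (tspace D) c t) = smul W c (tlift D W b t)" for c
      using lin eq[OF t] eq[OF closed(1)[OF t t]] t by (simp add: linmap_def)
    fix t' assume t': "t' \<in> elems (tspace D)"
    show "tlift D W b (t + t') = tlift D W b t + tlift D W b t'"
      using lin eq[OF t] eq[OF t'] eq[OF closed(2)[OF t t']] t t' by (simp add: linmap_def)
  qed
  show "tlift D W b (tens D x y) = b x y" if "x \<in> elems (lft D)" "y \<in> elems (rgt D)"
  proof -
    have "tens D x y \<in> F.span ?S" by (rule F.span_base) (use that in blast)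
    then have "tens D x y \<in> elems (tspace D)" by (simp add: tspace_def)
    then show ?thesis using that by (simp add: eq Lt)
  qed
qed


section \<open>Finite group schemes and normal subgroup schemes\<close>

text \<open>
  A finite group scheme is given by its coordinate ring, a finite-dimensional commutative Hopf
  algebra; the ring structure is the one of the type class.
\<close>

record ('k, 'a) group_scheme =
  scale :: "'k \<Rightarrow> 'a \<Rightarrow> 'a"
  comult :: "'a \<Rightarrow> ('a, 'a, 'k) tensor"
  counit :: "'a \<Rightarrow> 'k"
  antipode :: "'a \<Rightarrow> 'a"

definition coord :: "('k::field, 'a::comm_ring_1) group_scheme \<Rightarrow> ('k, 'a) space" where
  "coord G = \<lparr>elems = UNIV, smul = scale G\<rparr>"

definition AA :: "('k::field, 'a::comm_ring_1) group_scheme \<Rightarrow> ('k, 'a, 'k, 'a) tdata" where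
  "AA G = over_k (coord G) (coord G)"

definition AAA :: "('k::field, 'a::comm_ring_1) group_scheme
    \<Rightarrow> ('k, 'a, 'k, ('a, 'a, 'k) tensor) tdata" where
  "AAA G = over_k (coord G) (tspace (AA G))"

definition tensor_mult :: "('k::field, 'a::comm_ring_1) group_scheme
    \<Rightarrow> ('a, 'a, 'k) tensor \<Rightarrow> ('a, 'a, 'k) tensor \<Rightarrow> ('a, 'a, 'k) tensor" where
  "tensor_mult G s t = tlift (AA G) (tspace (AA G))
     (\<lambda>a b. tlift (AA G) (tspace (AA G)) (\<lambda>c d. tens (AA G) (a * c) (b * d)) t) s"

text \<open>The expression \<open>sweedler G W b a\<close> is \<open>\<Sum> b a\<^sub>(\<^sub>1\<^sub>) a\<^sub>(\<^sub>2\<^sub>)\<close> in Sweedler notation.\<close>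

definition sweedler :: "('k::field, 'a::comm_ring_1) group_scheme
    \<Rightarrow> ('k, 'w::ab_group_add) space \<Rightarrow> ('a \<Rightarrow> 'a \<Rightarrow> 'w) \<Rightarrow> 'a \<Rightarrow> 'w" where
  "sweedler G W b a = tlift (AA G) W b (comult G a)"

definition finite_group_scheme :: "('k::field, 'a::comm_ring_1) group_scheme \<Rightarrow> bool" where
  "finite_group_scheme G \<longleftrightarrow>
     is_space (coord G) \<and> fin_dim (coord G)
     \<and> (\<forall>c a b. scale G c (a * b) = scale G c a * b)
     \<and> linmap (coord G) (tspace (AA G)) (comult G)
     \<and> comult G 1 = tens (AA G) 1 1
     \<and> (\<forall>a b. comult G (a * b) = tensor_mult G (comult G a) (comult G b))
     \<and> linmap (coord G) base (counit G)
     \<and> counit G 1 = 1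
     \<and> (\<forall>a b. counit G (a * b) = counit G a * counit G b)
     \<and> (\<forall>a. sweedler G (tspace (AAA G))
              (\<lambda>x y. sweedler G (tspace (AAA G)) (\<lambda>u v. tens (AAA G) u (tens (AA G) v y)) x) a
            = sweedler G (tspace (AAA G)) (\<lambda>x y. tens (AAA G) x (comult G y)) a)
     \<and> (\<forall>a. sweedler G (coord G) (\<lambda>x y. scale G (counit G x) y) a = a)
     \<and> (\<forall>a. sweedler G (coord G) (\<lambda>x y. scale G (counit G y) x) a = a)
     \<and> linmap (coord G) (coord G) (antipode G)
     \<and> (\<forall>a. sweedler G (coord G) (\<lambda>x y. antipode G x * y) a = scale G (counit G a) 1)
     \<and> (\<forall>a. sweedler G (coord G) (\<lambda>x y. x * antipode G y) a = scale G (counit G a) 1)"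

definition ring_of :: "'a::comm_ring_1 set \<Rightarrow> 'a ring" where
  "ring_of B = \<lparr>carrier = B, mult = (*), one = 1, zero = 0, add = (+)\<rparr>"

text \<open>A subgroup scheme \<open>N\<close> of \<open>G\<close> is given by the kernel \<open>J\<close> of \<open>k[G] \<rightarrow> k[N]\<close>, a Hopf ideal.\<close>

definition subgroup_scheme :: "('k::field, 'a::comm_ring_1) group_scheme \<Rightarrow> 'a set \<Rightarrow> bool" where
  "subgroup_scheme G J \<longleftrightarrow> ideal J (ring_of UNIV)
     \<and> (\<forall>a\<in>J. comult G a \<in> module.span fscale {tens (AA G) x y |x y. x \<in> J \<or> y \<in> J})
     \<and> (\<forall>a\<in>J. counit G a = 0)
     \<and> (\<forall>a\<in>J. antipode G a \<in> J)"

text \<open>Normality: the comorphism \<open>a \<mapsto> \<Sum> a\<^sub>(\<^sub>2\<^sub>) \<otimes> a\<^sub>(\<^sub>1\<^sub>) S(a\<^sub>(\<^sub>3\<^sub>))\<close> of the conjugation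
  \<open>(x, g) \<mapsto> g x g\<inverse>\<close> maps \<open>J\<close> into \<open>J \<otimes> k[G]\<close>, the ideal of \<open>N \<times> G\<close>.\<close>

definition normal_subgroup_scheme :: "('k::field, 'a::comm_ring_1) group_scheme \<Rightarrow> 'a set \<Rightarrow> bool" where
  "normal_subgroup_scheme G J \<longleftrightarrow> subgroup_scheme G J
     \<and> (\<forall>a\<in>J. sweedler G (tspace (AA G))
            (\<lambda>x y. sweedler G (tspace (AA G)) (\<lambda>u v. tens (AA G) u (x * antipode G v)) y) a
          \<in> module.span fscale {tens (AA G) x y |x y. x \<in> J})"

text \<open>The invariants \<open>k[G]\<^sup>N\<close> under right translation, \<open>f(g x) = f(g)\<close> for \<open>x\<close> in \<open>N\<close>:
  \<open>\<Delta>(f) \<equiv> f \<otimes> 1\<close> modulo \<open>k[G] \<otimes> J\<close>.\<close>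

definition invariants :: "('k::field, 'a::comm_ring_1) group_scheme \<Rightarrow> 'a set \<Rightarrow> 'a set" where
  "invariants G J = {a. comult G a - tens (AA G) a 1
     \<in> module.span fscale {tens (AA G) x y |x y. y \<in> J}}"

definition infinitesimal_quotient :: "('k::field, 'a::comm_ring_1) group_scheme \<Rightarrow> 'a set \<Rightarrow> bool" where
  "infinitesimal_quotient G J \<longleftrightarrow> (\<exists>!M. maximalideal M (ring_of (invariants G J)))"

definition aug_ideal :: "('k::field, 'a::comm_ring_1) group_scheme \<Rightarrow> 'a set \<Rightarrow> 'a set" where
  "aug_ideal G J = invariants G J \<inter> J"


section \<open>Group algebras and the filtration of the induced module\<close>

definition conv :: "('k::field, 'a::comm_ring_1) group_scheme
    \<Rightarrow> ('a \<Rightarrow> 'k) \<Rightarrow> ('a \<Rightarrow> 'k) \<Rightarrow> ('a \<Rightarrow> 'k)" where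
  "conv G u v = sweedler G base (\<lambda>x y. u x * v y)"

definition group_alg :: "('k::field, 'a::comm_ring_1) group_scheme \<Rightarrow> ('k, 'a \<Rightarrow> 'k) alg" where
  "group_alg G = \<lparr>elems = {v. linmap (coord G) base v}, smul = fscale, prd = conv G, unt = counit G\<rparr>"

text \<open>The group algebra of \<open>N\<close>, the dual of \<open>k[G]/J\<close>, as a subalgebra of the one of \<open>G\<close>.\<close>

definition sub_group_alg :: "('k::field, 'a::comm_ring_1) group_scheme \<Rightarrow> 'a set
    \<Rightarrow> ('k, 'a \<Rightarrow> 'k) alg" where
  "sub_group_alg G J = (group_alg G)\<lparr>elems := {v \<in> elems (group_alg G). \<forall>x\<in>J. v x = 0}\<rparr>"

definition ind_data :: "('k::field, 'a::comm_ring_1) group_scheme \<Rightarrow> 'a set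
    \<Rightarrow> ('k, 'a \<Rightarrow> 'k, 'z::ab_group_add) lmod \<Rightarrow> ('k, 'a \<Rightarrow> 'k, 'a \<Rightarrow> 'k, 'z) tdata" where
  "ind_data G J Z = \<lparr>lft = space.truncate (group_alg G), rgt = space.truncate Z,
     mid = elems (sub_group_alg G J), ract = conv G, lact = act Z\<rparr>"

definition induced :: "('k::field, 'a::comm_ring_1) group_scheme \<Rightarrow> 'a set
    \<Rightarrow> ('k, 'a \<Rightarrow> 'k, 'z::ab_group_add) lmod
    \<Rightarrow> ('k, 'a \<Rightarrow> 'k, ('a \<Rightarrow> 'k, 'z, 'k) tensor) lmod" where
  "induced G J Z = \<lparr>elems = elems (tspace (ind_data G J Z)), smul = fscale,
     act = (\<lambda>g. tlift (ind_data G J Z) (tspace (ind_data G J Z))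
                  (\<lambda>h z. tens (ind_data G J Z) (conv G g h) z))\<rparr>"

definition ideal_power :: "'a::comm_ring_1 set \<Rightarrow> nat \<Rightarrow> 'a set" where
  "ideal_power J m = J [^]\<^bsub>ideals_set (ring_of UNIV)\<^esub> m"

definition filt_length :: "'a::comm_ring_1 set \<Rightarrow> nat" where
  "filt_length J = (LEAST n. ideal_power J (Suc n) = {0})"

definition H_filt :: "('k::field, 'a::comm_ring_1) group_scheme \<Rightarrow> 'a set \<Rightarrow> nat
    \<Rightarrow> ('a \<Rightarrow> 'k) set" where
  "H_filt G J l = {v \<in> elems (group_alg G). \<forall>x\<in>ideal_power J (Suc l). v x = 0}"

definition N_filt :: "('k::field, 'a::comm_ring_1) group_scheme \<Rightarrow> 'a set
    \<Rightarrow> ('k, 'a \<Rightarrow> 'k, 'z::ab_group_add) lmod \<Rightarrow> nat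
    \<Rightarrow> ('k, 'a \<Rightarrow> 'k, ('a \<Rightarrow> 'k, 'z, 'k) tensor) lmod" where
  "N_filt G J Z l = (induced G J Z)\<lparr>elems :=
     module.span fscale {tens (ind_data G J Z) h z |h z. h \<in> H_filt G J l \<and> z \<in> elems Z}\<rparr>"

text \<open>The endomorphism \<open>h \<otimes> z \<mapsto> (f\<^sup>l.h) \<otimes> z\<close>, where \<open>(x.h)(y) = h(y x)\<close>.\<close>

definition twist :: "('k::field, 'a::comm_ring_1) group_scheme \<Rightarrow> 'a set
    \<Rightarrow> ('k, 'a \<Rightarrow> 'k, 'z::ab_group_add) lmod \<Rightarrow> 'a \<Rightarrow> nat
    \<Rightarrow> ('a \<Rightarrow> 'k, 'z, 'k) tensor \<Rightarrow> ('a \<Rightarrow> 'k, 'z, 'k) tensor" where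
  "twist G J Z f l = tlift (ind_data G J Z) (tspace (ind_data G J Z))
     (\<lambda>h z. tens (ind_data G J Z) (\<lambda>y. h (y * f ^ l)) z)"

text \<open>The second map \<open>N\<^sub>l \<rightarrow> Z\<close> of the sequence: \<open>twist\<close> followed by the inverse of the
  identification \<open>Z \<cong> N\<^sub>0\<close>, \<open>z \<mapsto> 1 \<otimes> z\<close>, the unit of the group algebra being the counit.\<close>

definition quot_map :: "('k::field, 'a::comm_ring_1) group_scheme \<Rightarrow> 'a set
    \<Rightarrow> ('k, 'a \<Rightarrow> 'k, 'z::ab_group_add) lmod \<Rightarrow> 'a \<Rightarrow> nat
    \<Rightarrow> ('a \<Rightarrow> 'k, 'z, 'k) tensor \<Rightarrow> 'z" where
  "quot_map G J Z f l t =
     (THE z. z \<in> elems Z \<and> tens (ind_data G J Z) (counit G) z = twist G J Z f l t)"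

end

theory Submission
  imports Defs
begin

text \<open>
  A brick leaves no room for a splitting. By Frobenius reciprocity, a homomorphism of
  \<open>N\<close>-modules \<open>s : Z \<rightarrow> kG \<otimes> Z\<close> extends to a \<open>G\<close>-endomorphism of \<open>kG \<otimes> Z\<close>, namely
  \<open>h \<otimes> z \<mapsto> h \<cdot> s z\<close> (\<open>frobenius_extension\<close>). If \<open>kG \<otimes> Z\<close> is a brick, the extension is
  multiplication by some \<open>c\<close> in \<open>k\<close>, so \<open>s z = c (1 \<otimes> z)\<close> for all \<open>z\<close>
  (\<open>brick_induced_hom\<close>): every \<open>N\<close>-homomorphism from \<open>Z\<close> to the induced module has its image
  in \<open>N\<^sub>0\<close>.

  A section of \<open>N\<^sub>l \<rightarrow> Z\<close> is such a homomorphism. For \<open>l \<ge> 1\<close> the module \<open>N\<^sub>0\<close> lies in \<open>N\<^bsub>l-1\<^esub>\<close>,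
  which the projection kills. For an arbitrary exact sequence this is exactness; for the explicit
  projection it holds because \<open>f\<^sup>l\<close> acts on the counit by \<open>\<epsilon>(f)\<^sup>l = 0\<close>. The identity of \<open>Z\<close> is
  therefore zero, hence \<open>Z = 0\<close> and \<open>kG \<otimes> Z = 0\<close>, whose endomorphism ring is zero and not \<open>k\<close>
  (\<open>brick_induced_nonzero\<close>).

  Behind this lie the Hopf-algebraic facts that convolution is associative and unital, which makes
  \<open>kG \<otimes> Z\<close> a \<open>G\<close>-module, and that translation by a function invariant under \<open>N\<close> commutes with
  right convolution by elements of \<open>kN\<close> (\<open>conv_translate_invariant\<close>), which makes the explicit
  projection well defined.
\<close>

section \<open>Linear maps and tensor products\<close>

lemma is_space_closed:
  assumes "is_space V"
  shows "0 \<in> elems V"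
    and "x \<in> elems V \<Longrightarrow> y \<in> elems V \<Longrightarrow> x + y \<in> elems V"
    and "x \<in> elems V \<Longrightarrow> smul V c x \<in> elems V"
proof -
  interpret vector_space "smul V" using assms by (simp add: is_space_def)
  have "subspace (elems V)" using assms by (simp add: is_space_def)
  then show "0 \<in> elems V"
    and "x \<in> elems V \<Longrightarrow> y \<in> elems V \<Longrightarrow> x + y \<in> elems V"
    and "x \<in> elems V \<Longrightarrow> smul V c x \<in> elems V"
    by (simp_all add: subspace_0 subspace_add subspace_scale)
qed

lemma is_space_arith:
  assumes "is_space V"
  shows "smul V c (x + y) = smul V c x + smul V c y"
    and "smul V (c + d) x = smul V c x + smul V d x"
    and "smul V c (smul V d x) = smul V (c * d) x"
proof -
  interpret vector_space "smul V" using assms by (simp add: is_space_def)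
  show "smul V c (x + y) = smul V c x + smul V c y"
    and "smul V (c + d) x = smul V c x + smul V d x"
    and "smul V c (smul V d x) = smul V (c * d) x"
    by (simp_all add: scale_right_distrib scale_left_distrib)
qed

lemma is_space_base: "is_space (base :: ('k::field, 'k) space)"
proof -
  interpret vector_space "(*) :: 'k \<Rightarrow> 'k \<Rightarrow> 'k"
    by unfold_locales (auto simp: algebra_simps)
  show ?thesis
    by (auto simp: is_space_def base_def intro: vector_space_axioms subspaceI)
qed

lemma is_space_tspace: "is_space (tspace D)"
proof -
  interpret F: vector_space fscale by (rule vector_space_fscale)
  show ?thesis by (simp add: is_space_def tspace_def vector_space_fscale)
qed

lemma smul_tspace [simp]: "smul (tspace D) = fscale"
  by (simp add: tspace_def)

lemma linmapD:
  assumes "linmap V W f"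
  shows "x \<in> elems V \<Longrightarrow> f x \<in> elems W"
    and "x \<in> elems V \<Longrightarrow> y \<in> elems V \<Longrightarrow> f (x + y) = f x + f y"
    and "x \<in> elems V \<Longrightarrow> f (smul V c x) = smul W c (f x)"
  using assms by (simp_all add: linmap_def)

lemma linmap_0:
  assumes "linmap V W f" "is_space V"
  shows "f 0 = 0"
proof -
  have "f (0 + 0) = f 0 + f 0"
    using assms by (intro linmapD(2)) (auto simp: is_space_closed)
  then show ?thesis by simp
qed

lemma linmap_comp:
  "linmap U V f \<Longrightarrow> linmap V W g \<Longrightarrow> linmap U W (\<lambda>x. g (f x))"
  by (simp add: linmap_def)

lemma linmap_add:
  "linmap V W f \<Longrightarrow> linmap V W g \<Longrightarrow> is_space W \<Longrightarrow> linmap V W (\<lambda>x. f x + g x)"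
  by (simp add: linmap_def is_space_closed is_space_arith add_ac)

lemma linmap_smul:
  "linmap V W f \<Longrightarrow> is_space W \<Longrightarrow> linmap V W (\<lambda>x. smul W c (f x))"
  by (simp add: linmap_def is_space_closed is_space_arith mult.commute)

text \<open>Over the ground field, being balanced is part of bilinearity.\<close>

lemma balanced_over_kI:
  assumes "\<And>x. x \<in> elems V \<Longrightarrow> linmap W X (b x)"
    and "\<And>y. y \<in> elems W \<Longrightarrow> linmap V X (\<lambda>x. b x y)"
  shows "balanced (over_k V W) X b"
proof -
  have "b (smul V c x) y = smul X c (b x y)" "b x (smul W c y) = smul X c (b x y)"
    if "x \<in> elems V" "y \<in> elems W" for c x y
    using linmapD(3)[OF assms(1)] linmapD(3)[OF assms(2)] that by auto
  then show ?thesis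
    using assms by (simp add: balanced_def over_k_def)
qed

lemma tens_in_tspace:
  "x \<in> elems (lft D) \<Longrightarrow> y \<in> elems (rgt D) \<Longrightarrow> tens D x y \<in> elems (tspace D)"
proof -
  interpret F: vector_space fscale by (rule vector_space_fscale)
  assume "x \<in> elems (lft D)" "y \<in> elems (rgt D)"
  then show ?thesis by (auto simp: tspace_def intro: F.span_base)
qed

lemma balanced_tens: "balanced D (tspace D) (tens D)"
  unfolding balanced_def linmap_def
  by (intro conjI ballI allI tens_in_tspace)
     (auto simp: tens_def fun_eq_iff fscale_def balanced_def linmap_def base_def)

text \<open>The uniqueness half of the universal property, in the form used to compute induced maps.\<close>

lemma tlift_eqI:
  assumes "linmap (tspace D) W L" "is_space W" "balanced D W b"
    and "\<And>x y. x \<in> elems (lft D) \<Longrightarrow> y \<in> elems (rgt D) \<Longrightarrow> L (tens D x y) = b x y"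
    and "t \<in> elems (tspace D)"
  shows "tlift D W b t = L t"
  by (rule tlift_unique_aux[OF tensor_universal(1)[OF assms(3,2)] assms(1,2) _ assms(5)])
     (simp add: tensor_universal(2)[OF assms(3,2)] assms(4))

lemma balanced_comp:
  "balanced D W b \<Longrightarrow> linmap W W' L \<Longrightarrow> balanced D W' (\<lambda>x y. L (b x y))"
  by (simp add: balanced_def linmap_def)

lemma linmap_tlift:
  assumes "linmap W W' L" "is_space W" "is_space W'" "balanced D W b"
    and "t \<in> elems (tspace D)"
  shows "L (tlift D W b t) = tlift D W' (\<lambda>x y. L (b x y)) t"
  by (rule tlift_eqI[symmetric, OF linmap_comp[OF tensor_universal(1)[OF assms(4,2)] assms(1)]
        assms(3) balanced_comp[OF assms(4,1)] _ assms(5)])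
     (simp add: tensor_universal(2)[OF assms(4,2)])

lemma balanced_add:
  "balanced D W b \<Longrightarrow> balanced D W b' \<Longrightarrow> is_space W \<Longrightarrow> balanced D W (\<lambda>x y. b x y + b' x y)"
  by (simp add: balanced_def linmap_add)

lemma balanced_smul:
  "balanced D W b \<Longrightarrow> is_space W \<Longrightarrow> balanced D W (\<lambda>x y. smul W c (b x y))"
  by (simp add: balanced_def linmap_smul)

lemma tlift_add:
  assumes "balanced D W b" "balanced D W b'" "is_space W" "t \<in> elems (tspace D)"
  shows "tlift D W (\<lambda>x y. b x y + b' x y) t = tlift D W b t + tlift D W b' t"
  by (rule tlift_eqI[OF linmap_add[OF tensor_universal(1)[OF assms(1,3)]
        tensor_universal(1)[OF assms(2,3)] assms(3)] assms(3) balanced_add[OF assms(1-3)] _ assms(4)])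
     (simp add: tensor_universal(2)[OF assms(1,3)] tensor_universal(2)[OF assms(2,3)])

lemma tlift_smul:
  assumes "balanced D W b" "is_space W" "t \<in> elems (tspace D)"
  shows "tlift D W (\<lambda>x y. smul W c (b x y)) t = smul W c (tlift D W b t)"
  by (rule tlift_eqI[OF linmap_smul[OF tensor_universal(1)[OF assms(1,2)] assms(2)]
        assms(2) balanced_smul[OF assms(1,2)] _ assms(3)])
     (simp add: tensor_universal(2)[OF assms(1,2)])

text \<open>
  A family of balanced maps that depends linearly on a parameter induces linear maps that do so
  too: both sides of each linearity law are linear in \<open>t\<close> and agree on pure tensors. Iterated
  Sweedler sums and the dependence of \<open>g \<cdot> t\<close> on \<open>g\<close> are handled by this.
\<close>

lemma linmap_tlift_param:
  assumes bal: "\<And>v. v \<in> elems V \<Longrightarrow> balanced D W (b v)"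
    and lin: "\<And>x y. x \<in> elems (lft D) \<Longrightarrow> y \<in> elems (rgt D) \<Longrightarrow> linmap V W (\<lambda>v. b v x y)"
    and V: "is_space V" and W: "is_space W" and t: "t \<in> elems (tspace D)"
  shows "linmap V W (\<lambda>v. tlift D W (b v) t)"
proof -
  note U = tensor_universal[OF bal W]
  have "tlift D W (b (v + v')) t = tlift D W (b v) t + tlift D W (b v') t"
    if "v \<in> elems V" "v' \<in> elems V" for v v'
    by (rule tlift_eqI[OF linmap_add[OF U(1)[OF that(1)] U(1)[OF that(2)] W] W
          bal[OF is_space_closed(2)[OF V that]] _ t])
       (simp add: U(2) that linmapD(2)[OF lin])
  moreover have "tlift D W (b (smul V c v)) t = smul W c (tlift D W (b v) t)"
    if "v \<in> elems V" for v c
    by (rule tlift_eqI[OF linmap_smul[OF U(1)[OF that] W] W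
          bal[OF is_space_closed(3)[OF V that]] _ t])
       (simp add: U(2) that linmapD(3)[OF lin])
  ultimately show ?thesis
    using linmapD(1)[OF U(1)] t by (simp add: linmap_def)
qed


section \<open>The group algebra\<close>

lemma coord_simps [simp]: "elems (coord G) = UNIV" "smul (coord G) = scale G"
  by (simp_all add: coord_def)

lemma lft_AA [simp]: "lft (AA G) = coord G" and rgt_AA [simp]: "rgt (AA G) = coord G"
  by (simp_all add: AA_def over_k_def)

lemma AAA_simps [simp]: "lft (AAA G) = coord G" "rgt (AAA G) = tspace (AA G)"
  by (simp_all add: AAA_def over_k_def)

lemma group_alg_simps [simp]:
  "elems (group_alg G) = {v. linmap (coord G) base v}" "smul (group_alg G) = fscale"
  "prd (group_alg G) = conv G" "unt (group_alg G) = counit G"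
  by (simp_all add: group_alg_def)

lemma linmap_base_mult:
  "linmap V base u \<Longrightarrow> linmap V base (\<lambda>x. u x * c)"
  "linmap V base u \<Longrightarrow> linmap V base (\<lambda>x. c * u x)"
  by (simp_all add: linmap_def base_def algebra_simps)

lemma balanced_mult:
  assumes "linmap V base u" "linmap W base v"
  shows "balanced (over_k V W) base (\<lambda>x y. u x * v y)"
  using assms by (intro balanced_over_kI linmap_base_mult)

lemma balanced_AAI:
  assumes "\<And>x. linmap (coord G) W (b x)" "\<And>y. linmap (coord G) W (\<lambda>x. b x y)"
  shows "balanced (AA G) W b"
  unfolding AA_def by (rule balanced_over_kI) (rule assms)+

lemma linmap_sweedler:
  assumes "finite_group_scheme G" "balanced (AA G) W b" "is_space W"
  shows "linmap (coord G) W (sweedler G W b)"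
proof -
  have "linmap (coord G) (tspace (AA G)) (comult G)"
    using assms(1) by (simp add: finite_group_scheme_def)
  from linmap_comp[OF this tensor_universal(1)[OF assms(2,3)]] show ?thesis
    by (simp add: sweedler_def[abs_def])
qed

lemma comult_in_tspace: "finite_group_scheme G \<Longrightarrow> comult G a \<in> elems (tspace (AA G))"
  by (simp add: finite_group_scheme_def linmap_def)

text \<open>Linear maps can be pulled into Sweedler sums.\<close>

lemma linmap_apply_sweedler:
  assumes "finite_group_scheme G" "linmap W W' L" "is_space W" "is_space W'" "balanced (AA G) W b"
  shows "L (sweedler G W b a) = sweedler G W' (\<lambda>x y. L (b x y)) a"
  unfolding sweedler_def
  by (rule linmap_tlift[OF assms(2-5) comult_in_tspace[OF assms(1)]])

lemma conv_in_group_alg: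
  assumes "finite_group_scheme G" "linmap (coord G) base u" "linmap (coord G) base v"
  shows "linmap (coord G) base (conv G u v)"
  unfolding conv_def
  by (rule linmap_sweedler[OF assms(1) balanced_mult[OF assms(2,3), folded AA_def] is_space_base])

text \<open>Apply \<open>h\<close> to the counit axiom \<open>a = \<Sum> \<epsilon>(a\<^sub>(\<^sub>1\<^sub>)) a\<^sub>(\<^sub>2\<^sub>)\<close>.\<close>

lemma conv_counit_left:
  assumes G: "finite_group_scheme G" and h: "linmap (coord G) base h"
  shows "conv G (counit G) h = h"
proof
  fix a
  have sp: "is_space (coord G)" and eps: "linmap (coord G) base (counit G)"
    and id: "sweedler G (coord G) (\<lambda>x y. scale G (counit G x) y) a = a"
    using G by (simp_all add: finite_group_scheme_def)
  have "balanced (AA G) (coord G) (\<lambda>x y. scale G (counit G x) y)"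
    unfolding AA_def using is_space_arith[OF sp] eps
    by (intro balanced_over_kI) (auto simp: linmap_def base_def mult.commute)
  from linmap_apply_sweedler[OF G h sp is_space_base this, of a] id
  have "h a = sweedler G base (\<lambda>x y. h (scale G (counit G x) y)) a" by simp
  also have "(\<lambda>x y. h (scale G (counit G x) y)) = (\<lambda>x y. counit G x * h y)"
    using h by (simp add: linmap_def base_def)
  finally show "conv G (counit G) h a = h a" by (simp add: conv_def)
qed

text \<open>
  Coassociativity dualised: both sides are the image of one of the two equal elements of
  \<open>k[G] \<otimes> (k[G] \<otimes> k[G])\<close> under the functional \<open>u \<otimes> (v \<otimes> w)\<close>.
\<close>

lemma conv_assoc:
  assumes G: "finite_group_scheme G"
    and u: "linmap (coord G) base u" and v: "linmap (coord G) base v" and w: "linmap (coord G) base w"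
  shows "conv G (conv G u v) w = conv G u (conv G v w)"
proof
  fix a
  let ?T = "tspace (AA G)" and ?T3 = "tspace (AAA G)"
  have sp: "is_space (coord G)" and com: "linmap (coord G) ?T (comult G)"
    and coassoc: "sweedler G ?T3
        (\<lambda>x y. sweedler G ?T3 (\<lambda>p q. tens (AAA G) p (tens (AA G) q y)) x) a
      = sweedler G ?T3 (\<lambda>x y. tens (AAA G) x (comult G y)) a"
    using G by (simp_all add: finite_group_scheme_def)
  \<comment> \<open>\<open>M\<close> is the functional \<open>v \<otimes> w\<close>, and \<open>L\<close> below is \<open>u \<otimes> (v \<otimes> w)\<close>.\<close>
  define M where "M = tlift (AA G) base (\<lambda>q y. v q * w y)"
  have bvw: "balanced (AA G) base (\<lambda>q y. v q * w y)"
    unfolding AA_def by (rule balanced_mult[OF v w])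
  have M: "linmap ?T base M" "\<And>q y. M (tens (AA G) q y) = v q * w y"
    using tensor_universal[OF bvw is_space_base] by (simp_all add: M_def)
  define L where "L = tlift (AAA G) base (\<lambda>x t. u x * M t)"
  have buM: "balanced (AAA G) base (\<lambda>x t. u x * M t)"
    unfolding AAA_def by (rule balanced_mult[OF u M(1)])
  have L: "linmap ?T3 base L" "\<And>x t. t \<in> elems ?T \<Longrightarrow> L (tens (AAA G) x t) = u x * M t"
    using tensor_universal[OF buM is_space_base] by (simp_all add: L_def)
  have t2: "linmap (coord G) ?T (tens (AA G) q)" "linmap (coord G) ?T (\<lambda>q. tens (AA G) q y)" for q y
    using balanced_tens[of "AA G"] by (simp_all add: balanced_def)
  have t3: "linmap ?T ?T3 (tens (AAA G) q)"
    "t \<in> elems ?T \<Longrightarrow> linmap (coord G) ?T3 (\<lambda>q. tens (AAA G) q t)" for q t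
    using balanced_tens[of "AAA G"] by (simp_all add: balanced_def)
  have tin: "tens (AA G) q y \<in> elems ?T" for q y by (simp add: tens_in_tspace)
  have inner: "balanced (AA G) ?T3 (\<lambda>p q. tens (AAA G) p (tens (AA G) q y))" for y
    by (rule balanced_AAI[OF linmap_comp[OF t2(2) t3(1)] t3(2)[OF tin]])
  have outer: "balanced (AA G) ?T3
      (\<lambda>x y. sweedler G ?T3 (\<lambda>p q. tens (AAA G) p (tens (AA G) q y)) x)"
  proof -
    have "linmap (coord G) ?T3 (\<lambda>y. sweedler G ?T3 (\<lambda>p q. tens (AAA G) p (tens (AA G) q y)) x)" for x
      unfolding sweedler_def
      by (rule linmap_tlift_param[OF inner linmap_comp[OF t2(1) t3(1)] sp is_space_tspace
            comult_in_tspace[OF G]])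
    then show ?thesis
      by (rule balanced_AAI[OF _ linmap_sweedler[OF G inner is_space_tspace]])
  qed
  have right: "balanced (AA G) ?T3 (\<lambda>x y. tens (AAA G) x (comult G y))"
    by (rule balanced_AAI[OF linmap_comp[OF com t3(1)] t3(2)[OF comult_in_tspace[OF G]]])
  note push = linmap_apply_sweedler[OF G L(1) is_space_tspace is_space_base]
  have "conv G (conv G u v) w a = sweedler G base (\<lambda>x y. conv G u v x * w y) a"
    by (simp add: conv_def)
  also have "(\<lambda>x y. conv G u v x * w y)
      = (\<lambda>x y. L (sweedler G ?T3 (\<lambda>p q. tens (AAA G) p (tens (AA G) q y)) x))"
  proof (intro ext)
    fix x y
    have buv: "balanced (AA G) base (\<lambda>p q. u p * v q)"
      unfolding AA_def by (rule balanced_mult[OF u v])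
    have "linmap base base (\<lambda>c. c * w y)" by (auto simp: linmap_def base_def algebra_simps)
    from linmap_apply_sweedler[OF G this is_space_base is_space_base buv, of x]
    have "conv G u v x * w y = sweedler G base (\<lambda>p q. u p * v q * w y) x"
      by (simp add: conv_def)
    then show "conv G u v x * w y = L (sweedler G ?T3 (\<lambda>p q. tens (AAA G) p (tens (AA G) q y)) x)"
      by (simp add: push[OF inner] L M tin mult.assoc)
  qed
  also have "sweedler G base \<dots> a = L (sweedler G ?T3 (\<lambda>x y. tens (AAA G) x (comult G y)) a)"
    by (simp only: push[OF outer, symmetric] coassoc)
  also have "\<dots> = sweedler G base (\<lambda>x y. u x * M (comult G y)) a"
    by (simp add: push[OF right] L comult_in_tspace[OF G])
  also have "\<dots> = conv G u (conv G v w) a"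
    by (simp add: conv_def M_def sweedler_def)
  finally show "conv G (conv G u v) w a = conv G u (conv G v w) a" .
qed

lemma is_space_group_alg: "is_space (group_alg G)"
proof -
  interpret F: vector_space fscale by (rule vector_space_fscale)
  show ?thesis
    by (auto simp: is_space_def vector_space_fscale F.subspace_def linmap_def base_def fscale_def
        algebra_simps)
qed

lemma linmap_conv:
  assumes G: "finite_group_scheme G" and u: "linmap (coord G) base u"
  shows "linmap (group_alg G) (group_alg G) (conv G u)"
    and "linmap (group_alg G) (group_alg G) (\<lambda>v. conv G v u)"
proof -
  have bal: "balanced (AA G) base (\<lambda>x y. v x * w y)"
    if "linmap (coord G) base v" "linmap (coord G) base w" for v w
    using balanced_mult[OF that] by (simp add: AA_def)
  have add: "conv G v (w + w') = conv G v w + conv G v w'"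
    "conv G (w + w') v = conv G w v + conv G w' v"
    if "linmap (coord G) base v" "linmap (coord G) base w" "linmap (coord G) base w'" for v w w'
    using tlift_add[OF bal[OF that(1,2)] bal[OF that(1,3)] is_space_base comult_in_tspace[OF G]]
      tlift_add[OF bal[OF that(2,1)] bal[OF that(3,1)] is_space_base comult_in_tspace[OF G]]
    by (simp_all add: conv_def sweedler_def fun_eq_iff algebra_simps)
  have smul: "conv G v (fscale c w) = fscale c (conv G v w)"
    "conv G (fscale c w) v = fscale c (conv G w v)"
    if "linmap (coord G) base v" "linmap (coord G) base w" for v w c
    using tlift_smul[OF bal[OF that] is_space_base comult_in_tspace[OF G], of c]
      tlift_smul[OF bal[OF that(2,1)] is_space_base comult_in_tspace[OF G], of c]
    by (simp_all add: conv_def sweedler_def fun_eq_iff fscale_def base_def algebra_simps)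
  show "linmap (group_alg G) (group_alg G) (conv G u)"
    and "linmap (group_alg G) (group_alg G) (\<lambda>v. conv G v u)"
    by (simp_all add: linmap_def[of "group_alg G"] add smul u conv_in_group_alg[OF G])
qed

lemma counit_in_group_alg: "finite_group_scheme G \<Longrightarrow> linmap (coord G) base (counit G)"
  by (simp add: finite_group_scheme_def)

lemma sub_group_alg_simps [simp]:
  "elems (sub_group_alg G J) = {v. linmap (coord G) base v \<and> (\<forall>x\<in>J. v x = 0)}"
  "smul (sub_group_alg G J) = fscale"
  "prd (sub_group_alg G J) = conv G" "unt (sub_group_alg G J) = counit G"
  by (simp_all add: sub_group_alg_def group_alg_def)

lemma linmap_mult_coord:
  assumes "finite_group_scheme G"
  shows "linmap (coord G) (coord G) (\<lambda>y. x * y)" "linmap (coord G) (coord G) (\<lambda>y. y * x)"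
proof -
  have *: "scale G c (a * b) = scale G c a * b" for a b c
    using assms by (simp add: finite_group_scheme_def)
  show "linmap (coord G) (coord G) (\<lambda>y. y * x)"
    by (simp add: linmap_def distrib_right *)
  then show "linmap (coord G) (coord G) (\<lambda>y. x * y)"
    by (simp add: mult.commute)
qed

lemma linmap_span_eq_0:
  assumes L: "linmap (tspace D) W L" and W: "is_space W"
    and S: "S \<subseteq> elems (tspace D)" and zero: "\<And>t. t \<in> S \<Longrightarrow> L t = 0"
    and t: "t \<in> module.span fscale S"
  shows "L t = 0" "t \<in> elems (tspace D)"
proof -
  interpret F: vector_space fscale by (rule vector_space_fscale)
  interpret V: vector_space "smul W" using W by (simp add: is_space_def)
  note T = is_space_closed[OF is_space_tspace[of D]]
  have "F.subspace {t \<in> elems (tspace D). L t = 0}"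
    using T linmapD[OF L] linmap_0[OF L is_space_tspace]
    by (auto simp: F.subspace_def)
  with S zero have "F.span S \<subseteq> {t \<in> elems (tspace D). L t = 0}"
    by (intro F.span_minimal) auto
  with t show "L t = 0" "t \<in> elems (tspace D)" by auto
qed

text \<open>
  Invariance says \<open>\<Delta>(x) = x \<otimes> 1\<close> modulo \<open>k[G] \<otimes> J\<close>. In
  \<open>(h * r)(y x) = \<Sum> h(y\<^sub>(\<^sub>1\<^sub>) x\<^sub>(\<^sub>1\<^sub>)) r(y\<^sub>(\<^sub>2\<^sub>) x\<^sub>(\<^sub>2\<^sub>))\<close> the error term contributes nothing, because
  \<open>r\<close> vanishes on the ideal \<open>J\<close>; what is left is \<open>\<Sum> h(y\<^sub>(\<^sub>1\<^sub>) x) r(y\<^sub>(\<^sub>2\<^sub>))\<close>.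
\<close>

lemma conv_translate_invariant:
  assumes G: "finite_group_scheme G" and J: "ideal J (ring_of UNIV)" and x: "x \<in> invariants G J"
    and h: "linmap (coord G) base h" and r: "r \<in> elems (sub_group_alg G J)"
  shows "conv G h r (y * x) = conv G (\<lambda>y. h (y * x)) r y"
proof -
  let ?T = "tspace (AA G)"
  have sp: "is_space (coord G)"
    and com: "comult G (y * x) = tensor_mult G (comult G y) (comult G x)"
    using G by (simp_all add: finite_group_scheme_def)
  from r have r: "linmap (coord G) base r" and rJ: "\<And>v. v \<in> J \<Longrightarrow> r v = 0" by auto
  define E where "E = tlift (AA G) base (\<lambda>a b. h a * r b)"
  have E: "linmap ?T base E" "\<And>a b. E (tens (AA G) a b) = h a * r b"
    using tensor_universal[OF balanced_mult[OF h r, folded AA_def] is_space_base]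
    by (simp_all add: E_def)
  have t2: "linmap (coord G) ?T (tens (AA G) q)" "linmap (coord G) ?T (\<lambda>q. tens (AA G) q y)" for q y
    using balanced_tens[of "AA G"] by (simp_all add: balanced_def)
  note m = linmap_mult_coord[OF G]
  note cx = comult_in_tspace[OF G, of x]
  have inner: "balanced (AA G) ?T (\<lambda>c d. tens (AA G) (a * c) (b * d))" for a b
    by (rule balanced_AAI[OF linmap_comp[OF m(1) t2(1)] linmap_comp[OF m(1) t2(2)]])
  \<comment> \<open>\<open>P a b\<close> is multiplication by \<open>a \<otimes> b\<close>.\<close>
  define P where "P a b = tlift (AA G) ?T (\<lambda>c d. tens (AA G) (a * c) (b * d))" for a b
  have P: "linmap ?T ?T (P a b)" "P a b (tens (AA G) c d) = tens (AA G) (a * c) (b * d)" for a b c d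
    using tensor_universal[OF inner is_space_tspace] by (simp_all add: P_def)
  have outer: "balanced (AA G) ?T (\<lambda>a b. P a b (comult G x))"
    unfolding P_def
    by (rule balanced_AAI[OF
          linmap_tlift_param[OF inner linmap_comp[OF m(2) t2(1)] sp is_space_tspace cx]
          linmap_tlift_param[OF inner linmap_comp[OF m(2) t2(2)] sp is_space_tspace cx]])
  have key: "E (P a b (comult G x)) = h (a * x) * r b" for a b
  proof -
    \<comment> \<open>\<open>d\<close> is the error term in \<open>k[G] \<otimes> J\<close>.\<close>
    define d where "d = comult G x - tens (AA G) x 1"
    have d: "d \<in> module.span fscale {tens (AA G) u v |u v. v \<in> J}"
      using x by (simp add: invariants_def d_def)
    have EP: "linmap ?T base (\<lambda>t. E (P a b t))"
      by (rule linmap_comp[OF P(1) E(1)])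
    have bJ: "b * v \<in> J" if "v \<in> J" for v
      using ideal.I_l_closed[OF J that, of b] by (simp add: ring_of_def)
    have "E (P a b d) = 0" "d \<in> elems ?T"
      by (rule linmap_span_eq_0[OF EP is_space_base _ _ d];
          auto simp: P E rJ bJ tens_in_tspace)+
    moreover have "comult G x = tens (AA G) x 1 + d" by (simp add: d_def)
    moreover have "tens (AA G) x 1 \<in> elems ?T" by (simp add: tens_in_tspace)
    ultimately have "E (P a b (comult G x)) = E (P a b (tens (AA G) x 1)) + 0"
      using linmapD(2)[OF EP] by metis
    then show ?thesis by (simp add: P E)
  qed
  have "conv G h r (y * x) = E (tensor_mult G (comult G y) (comult G x))"
    by (simp add: conv_def sweedler_def E_def com)
  also have "\<dots> = E (tlift (AA G) ?T (\<lambda>a b. P a b (comult G x)) (comult G y))"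
    by (simp add: tensor_mult_def P_def)
  also have "\<dots> = tlift (AA G) base (\<lambda>a b. E (P a b (comult G x))) (comult G y)"
    by (rule linmap_tlift[OF E(1) is_space_tspace is_space_base outer comult_in_tspace[OF G]])
  also have "\<dots> = conv G (\<lambda>y. h (y * x)) r y"
    by (simp add: key conv_def sweedler_def)
  finally show ?thesis .
qed

lemma conv_translate_invariant_power:
  assumes G: "finite_group_scheme G" and J: "ideal J (ring_of UNIV)" and x: "x \<in> invariants G J"
    and h: "linmap (coord G) base h" and r: "r \<in> elems (sub_group_alg G J)"
  shows "conv G h r (y * x ^ l) = conv G (\<lambda>y. h (y * x ^ l)) r y"
  using h
proof (induction l arbitrary: h y)
  case (Suc l)
  have "conv G h r (y * x ^ Suc l) = conv G h r (y * x ^ l * x)"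
    by (simp add: mult_ac)
  also have "\<dots> = conv G (\<lambda>y. h (y * x)) r (y * x ^ l)"
    by (rule conv_translate_invariant[OF G J x Suc.prems r])
  also have "\<dots> = conv G (\<lambda>y. h (y * x ^ l * x)) r y"
    by (rule Suc.IH[OF linmap_comp[OF linmap_mult_coord(2)[OF G] Suc.prems]])
  finally show ?case by (simp add: mult_ac)
qed simp


section \<open>The induced module\<close>

lemma elems_truncate [simp]: "elems (space.truncate V) = elems V"
  by (simp add: space.truncate_def)

lemma linmap_truncate: "linmap (space.truncate V) W b \<longleftrightarrow> linmap V W b"
  by (simp add: linmap_def space.truncate_def)

lemma balanced_ind_data_iff:
  "balanced (ind_data G J Z) W b \<longleftrightarrow>
     (\<forall>h. linmap (coord G) base h \<longrightarrow> linmap Z W (b h))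
     \<and> (\<forall>z\<in>elems Z. linmap (group_alg G) W (\<lambda>h. b h z))
     \<and> (\<forall>h. linmap (coord G) base h \<longrightarrow> (\<forall>r\<in>elems (sub_group_alg G J). \<forall>z\<in>elems Z.
          b (conv G h r) z = b h (act Z r z)))"
  by (simp add: balanced_def ind_data_def linmap_truncate)

lemma elems_ind_data [simp]:
  "elems (lft (ind_data G J Z)) = {h. linmap (coord G) base h}"
  "elems (rgt (ind_data G J Z)) = elems Z"
  by (simp_all add: ind_data_def)

lemma linmap_tens_ind_data:
  shows "linmap (coord G) base h \<Longrightarrow> linmap Z (tspace (ind_data G J Z)) (tens (ind_data G J Z) h)"
    and "z \<in> elems Z \<Longrightarrow> linmap (group_alg G) (tspace (ind_data G J Z)) (\<lambda>h. tens (ind_data G J Z) h z)"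
    and "linmap (coord G) base h \<Longrightarrow> r \<in> elems (sub_group_alg G J) \<Longrightarrow> z \<in> elems Z \<Longrightarrow>
      tens (ind_data G J Z) (conv G h r) z = tens (ind_data G J Z) h (act Z r z)"
  using balanced_tens[of "ind_data G J Z"] unfolding balanced_ind_data_iff by blast+

lemma induced_simps [simp]:
  "elems (induced G J Z) = elems (tspace (ind_data G J Z))" "smul (induced G J Z) = fscale"
  by (simp_all add: induced_def)

locale induction_from_subgroup =
  fixes G :: "('k::field, 'a::comm_ring_1) group_scheme" and J :: "'a set"
    and Z :: "('k, 'a \<Rightarrow> 'k, 'z::ab_group_add) lmod"
  assumes G: "finite_group_scheme G" and Z: "is_module (sub_group_alg G J) Z"
begin

abbreviation "D \<equiv> ind_data G J Z"
abbreviation "T \<equiv> tspace D"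
abbreviation "action \<equiv> act (induced G J Z)"

lemma is_space_Z: "is_space Z"
  using Z by (simp add: is_module_def)

lemma tens_in_T: "linmap (coord G) base h \<Longrightarrow> z \<in> elems Z \<Longrightarrow> tens D h z \<in> elems T"
  by (simp add: tens_in_tspace)

text \<open>
  The left action of \<open>kG\<close> is compatible with the tensor relation over \<open>kN\<close> because convolution
  is associative.
\<close>

lemma balanced_action:
  assumes g: "linmap (coord G) base g"
  shows "balanced D T (\<lambda>h. tens D (conv G g h))"
  unfolding balanced_ind_data_iff
proof (intro conjI allI impI ballI)
  fix h assume h: "linmap (coord G) base h"
  note gh = conv_in_group_alg[OF G g h]
  show "linmap Z T (tens D (conv G g h))" by (rule linmap_tens_ind_data(1)[OF gh])
  fix r z assume r: "r \<in> elems (sub_group_alg G J)" and z: "z \<in> elems Z"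
  show "tens D (conv G g (conv G h r)) z = tens D (conv G g h) (act Z r z)"
    using linmap_tens_ind_data(3)[OF gh r z] conv_assoc[OF G g h] r by simp
next
  fix z assume z: "z \<in> elems Z"
  show "linmap (group_alg G) T (\<lambda>h. tens D (conv G g h) z)"
    by (rule linmap_comp[OF linmap_conv(1)[OF G g] linmap_tens_ind_data(2)[OF z]])
qed

lemma action_eq: "action g = tlift D T (\<lambda>h. tens D (conv G g h))"
  by (simp add: induced_def)

lemma action_tens:
  assumes "linmap (coord G) base g" "linmap (coord G) base h" "z \<in> elems Z"
  shows "action g (tens D h z) = tens D (conv G g h) z"
  using tensor_universal(2)[OF balanced_action[OF assms(1)] is_space_tspace] assms
  by (simp add: action_eq)

lemma linmap_action: "linmap (coord G) base g \<Longrightarrow> linmap T T (action g)"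
  unfolding action_eq by (rule tensor_universal(1)[OF balanced_action is_space_tspace])

lemma linmap_action_left:
  assumes "t \<in> elems T"
  shows "linmap (group_alg G) T (\<lambda>g. action g t)"
  unfolding action_eq
proof (rule linmap_tlift_param[OF _ _ is_space_group_alg is_space_tspace assms])
  fix g assume "g \<in> elems (group_alg G)"
  then show "balanced D T (\<lambda>h. tens D (conv G g h))" by (simp add: balanced_action)
next
  fix h z assume "h \<in> elems (lft D)" "z \<in> elems (rgt D)"
  then show "linmap (group_alg G) T (\<lambda>g. tens D (conv G g h) z)"
    by (intro linmap_comp[OF linmap_conv(2)[OF G] linmap_tens_ind_data(2)]) auto
qed

lemma action_conv:
  assumes g: "linmap (coord G) base g" and h: "linmap (coord G) base h" and t: "t \<in> elems T"
  shows "action (conv G g h) t = action g (action h t)"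
proof (rule tlift_unique_aux[OF linmap_action[OF conv_in_group_alg[OF G g h]]
      linmap_comp[OF linmap_action[OF h] linmap_action[OF g]] is_space_tspace _ t])
  fix u z assume "u \<in> elems (lft D)" "z \<in> elems (rgt D)"
  then show "action (conv G g h) (tens D u z) = action g (action h (tens D u z))"
    using g h by (simp add: action_tens conv_in_group_alg[OF G] conv_assoc[OF G])
qed

lemma action_counit:
  assumes t: "t \<in> elems T"
  shows "action (counit G) t = t"
proof -
  have id: "linmap T T (\<lambda>t. t)" by (simp add: linmap_def)
  show ?thesis
    by (rule tlift_unique_aux[OF linmap_action[OF counit_in_group_alg[OF G]] id is_space_tspace _ t])
       (simp add: action_tens counit_in_group_alg[OF G] conv_counit_left[OF G])
qed

text \<open>
  The half of Frobenius reciprocity that produces \<open>G\<close>-endomorphisms. The assignment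
  \<open>h \<otimes> z \<mapsto> h \<cdot> s z\<close> respects the tensor relation since \<open>(h * r) \<cdot> s z = h \<cdot> s(r z)\<close> for \<open>r\<close>
  in \<open>kN\<close>.
\<close>

lemma frobenius_extension:
  assumes s: "is_hom (sub_group_alg G J) Z (induced G J Z) s"
  obtains S where "S \<in> Hom (group_alg G) (induced G J Z) (induced G J Z)"
    and "\<forall>z\<in>elems Z. S (tens D (counit G) z) = s z"
proof -
  have slin: "linmap Z T s"
    and sr: "\<And>r z. r \<in> elems (sub_group_alg G J) \<Longrightarrow> z \<in> elems Z \<Longrightarrow> s (act Z r z) = action r (s z)"
    using s by (simp_all add: is_hom_def linmap_def)
  note sT = linmapD(1)[OF slin]
  have bal: "balanced D T (\<lambda>h z. action h (s z))"
    unfolding balanced_ind_data_iff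
  proof (intro conjI allI impI ballI)
    fix h assume h: "linmap (coord G) base h"
    show "linmap Z T (\<lambda>z. action h (s z))" by (rule linmap_comp[OF slin linmap_action[OF h]])
    fix r z assume r: "r \<in> elems (sub_group_alg G J)" and z: "z \<in> elems Z"
    show "action (conv G h r) (s z) = action h (s (act Z r z))"
      using action_conv[OF h _ sT[OF z]] r sr[OF r z] by simp
  next
    fix z assume "z \<in> elems Z"
    then show "linmap (group_alg G) T (\<lambda>h. action h (s z))" by (rule linmap_action_left[OF sT])
  qed
  define S where "S = tlift D T (\<lambda>h z. action h (s z))"
  have S: "linmap T T S"
    "\<And>h z. linmap (coord G) base h \<Longrightarrow> z \<in> elems Z \<Longrightarrow> S (tens D h z) = action h (s z)"
    using tensor_universal[OF bal is_space_tspace] by (simp_all add: S_def)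
  have equiv: "S (action g t) = action g (S t)" if g: "linmap (coord G) base g" and t: "t \<in> elems T" for g t
  proof (rule tlift_unique_aux[OF linmap_comp[OF linmap_action[OF g] S(1)]
        linmap_comp[OF S(1) linmap_action[OF g]] is_space_tspace _ t])
    fix h z assume "h \<in> elems (lft D)" "z \<in> elems (rgt D)"
    then show "S (action g (tens D h z)) = action g (S (tens D h z))"
      using g by (simp add: action_tens S conv_in_group_alg[OF G] action_conv sT)
  qed
  \<comment> \<open>Elements of \<open>Hom\<close> vanish outside the module.\<close>
  define S' where "S' t = (if t \<in> elems T then S t else 0)" for t
  show ?thesis
  proof
    have "linmap T T S'"
      using S(1) is_space_closed[OF is_space_tspace[of D]] by (simp add: linmap_def S'_def)
    then have "linmap (induced G J Z) (induced G J Z) S'" by (simp add: linmap_def)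
    moreover have "S' (action g t) = action g (S' t)"
      if "linmap (coord G) base g" "t \<in> elems T" for g t
      using that equiv linmapD(1)[OF linmap_action] by (simp add: S'_def)
    ultimately show "S' \<in> Hom (group_alg G) (induced G J Z) (induced G J Z)"
      by (simp add: Hom_def is_hom_def S'_def)
    show "\<forall>z\<in>elems Z. S' (tens D (counit G) z) = s z"
      by (simp add: S'_def S tens_in_T counit_in_group_alg[OF G] action_counit sT)
  qed
qed

text \<open>
  The endomorphism extending \<open>s\<close> is a scalar, and \<open>s\<close> is recovered from it on \<open>1 \<otimes> Z\<close>.
\<close>

lemma brick_induced_hom:
  assumes "brick (group_alg G) (induced G J Z)" and "is_hom (sub_group_alg G J) Z (induced G J Z) s"
  obtains c where "\<forall>z\<in>elems Z. s z = fscale c (tens D (counit G) z)"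
proof -
  obtain S where S: "S \<in> Hom (group_alg G) (induced G J Z) (induced G J Z)"
    and Ss: "\<forall>z\<in>elems Z. S (tens D (counit G) z) = s z"
    by (rule frobenius_extension[OF assms(2)])
  obtain \<phi> where \<phi>: "bij_betw \<phi> UNIV (Hom (group_alg G) (induced G J Z) (induced G J Z))"
    "\<And>c d. \<phi> (c * d) = (\<lambda>x. fscale c (\<phi> d x))" "\<And>x. x \<in> elems T \<Longrightarrow> \<phi> 1 x = x"
    using assms(1) unfolding brick_def by auto
  obtain c where "S = \<phi> c" using S \<phi>(1) by (auto simp: bij_betw_def)
  then have "S t = fscale c t" if "t \<in> elems T" for t
    using \<phi>(2)[of c 1] \<phi>(3)[OF that] by simp
  then have "\<forall>z\<in>elems Z. s z = fscale c (tens D (counit G) z)"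
    using Ss tens_in_T[OF counit_in_group_alg[OF G]] by metis
  then show ?thesis by (rule that)
qed

text \<open>If \<open>Z\<close> were zero, the endomorphism ring would be zero, but \<open>0 \<noteq> 1\<close> in \<open>k\<close>.\<close>

lemma brick_induced_nonzero:
  assumes "brick (group_alg G) (induced G J Z)"
  obtains z where "z \<in> elems Z" "z \<noteq> 0"
proof (rule ccontr)
  assume "\<not> thesis"
  with that have Z0: "\<And>z. z \<in> elems Z \<Longrightarrow> z = 0" by blast
  interpret F: vector_space fscale by (rule vector_space_fscale)
  have "tens D h z = 0" if "linmap (coord G) base h" "z \<in> elems Z" for h z
    using linmap_0[OF linmap_tens_ind_data(1)[OF that(1)] is_space_Z] Z0[OF that(2)] by simp
  then have "{tens D h z |h z. h \<in> elems (lft D) \<and> z \<in> elems (rgt D)} \<subseteq> {0}" by auto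
  from F.span_mono[OF this] have T0: "t = 0" if "t \<in> elems T" for t
    using that by (auto simp: tspace_def F.span_insert_0)
  have zero: "S = (\<lambda>_. 0)" if S: "S \<in> Hom (group_alg G) (induced G J Z) (induced G J Z)" for S
  proof
    fix t show "S t = 0"
      using S T0 by (cases "t \<in> elems T") (auto simp: Hom_def is_hom_def linmap_def)
  qed
  obtain \<phi> :: "'k \<Rightarrow> _" where "bij_betw \<phi> UNIV (Hom (group_alg G) (induced G J Z) (induced G J Z))"
    using assms unfolding brick_def by blast
  then have "inj \<phi>" and "\<phi> c = (\<lambda>_. 0)" for c
    using zero by (auto simp: bij_betw_def)
  then have "\<phi> 0 = \<phi> 1" by metis
  with \<open>inj \<phi>\<close> show False by (simp add: inj_eq)
qed

text \<open>
  The substance is that \<open>h \<otimes> z \<mapsto> (f\<^sup>l.h) \<otimes> z\<close> respects the tensor relation over \<open>kN\<close>, which is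
  where \<open>f\<close> has to be invariant.
\<close>

lemma linmap_twist:
  assumes J: "ideal J (ring_of UNIV)" and f: "f \<in> invariants G J"
  shows "linmap T T (twist G J Z f l)"
    and "linmap (coord G) base h \<Longrightarrow> z \<in> elems Z \<Longrightarrow>
      twist G J Z f l (tens D h z) = tens D (\<lambda>y. h (y * f ^ l)) z"
proof -
  have translate: "linmap (coord G) base (\<lambda>y. h (y * f ^ l))" if "linmap (coord G) base h" for h
    by (rule linmap_comp[OF linmap_mult_coord(2)[OF G] that])
  have bal: "balanced D T (\<lambda>h. tens D (\<lambda>y. h (y * f ^ l)))"
    unfolding balanced_ind_data_iff
  proof (intro conjI allI impI ballI)
    fix h assume h: "linmap (coord G) base h"
    show "linmap Z T (tens D (\<lambda>y. h (y * f ^ l)))"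
      by (rule linmap_tens_ind_data(1)[OF translate[OF h]])
    fix r z assume r: "r \<in> elems (sub_group_alg G J)" and z: "z \<in> elems Z"
    show "tens D (\<lambda>y. conv G h r (y * f ^ l)) z = tens D (\<lambda>y. h (y * f ^ l)) (act Z r z)"
      unfolding conv_translate_invariant_power[OF G J f h r]
      by (rule linmap_tens_ind_data(3)[OF translate[OF h] r z])
  next
    fix z assume z: "z \<in> elems Z"
    have "linmap (group_alg G) (group_alg G) (\<lambda>h y. h (y * f ^ l))"
      by (simp add: linmap_def[of "group_alg G"] translate fun_eq_iff fscale_def)
    then show "linmap (group_alg G) T (\<lambda>h. tens D (\<lambda>y. h (y * f ^ l)) z)"
      by (rule linmap_comp[OF _ linmap_tens_ind_data(2)[OF z]])
  qed
  show "linmap T T (twist G J Z f l)"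
    and "linmap (coord G) base h \<Longrightarrow> z \<in> elems Z \<Longrightarrow>
      twist G J Z f l (tens D h z) = tens D (\<lambda>y. h (y * f ^ l)) z"
    using tensor_universal[OF bal is_space_tspace] by (simp_all add: twist_def)
qed

lemma is_hom_N_filt_induced:
  assumes "is_hom (sub_group_alg G J) Z (N_filt G J Z l) s"
  shows "is_hom (sub_group_alg G J) Z (induced G J Z) s"
proof -
  interpret F: vector_space fscale by (rule vector_space_fscale)
  have "{tens D h z |h z. h \<in> H_filt G J l \<and> z \<in> elems Z}
      \<subseteq> {tens D h z |h z. h \<in> elems (lft D) \<and> z \<in> elems (rgt D)}"
    by (auto simp: H_filt_def)
  then have sub: "elems (N_filt G J Z l) \<subseteq> elems (induced G J Z)"
    unfolding induced_simps by (simp add: N_filt_def tspace_def F.span_mono)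
  have "smul (N_filt G J Z l) = smul (induced G J Z)" "act (N_filt G J Z l) = act (induced G J Z)"
    by (simp_all add: N_filt_def)
  with assms sub show ?thesis
    unfolding is_hom_def linmap_def by (simp add: subset_iff)
qed

end


section \<open>The non-splitting\<close>

lemma ideal_power_Suc_subset:
  assumes J: "ideal J (ring_of UNIV)"
  shows "ideal_power J (Suc m) \<subseteq> J"
proof
  interpret ideal J "ring_of UNIV" by (rule J)
  fix x assume "x \<in> ideal_power J (Suc m)"
  then have "x \<in> ideal_prod (ring_of UNIV) (ideal_power J m) J"
    by (simp add: ideal_power_def ideals_set_def nat_pow_def)
  then show "x \<in> J"
  proof induction
    case (prod i j)
    then show ?case using I_l_closed[of j i] by (simp add: ring_of_def)
  next
    case (sum s t)
    then show ?case using a_closed by simp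
  qed
qed

theorem proposition2p4:
  fixes G :: "('k::field, 'a::comm_ring_1) group_scheme"
    and J :: "'a set"
    and Z :: "('k, 'a \<Rightarrow> 'k, 'z::ab_group_add) lmod"
    and f :: 'a
    and p :: nat
  assumes "CHAR('k) = p" and "p > 0"
    and "finite_group_scheme G"
    and "normal_subgroup_scheme G J"
    and "infinitesimal_quotient G J"
    and "is_module (sub_group_alg G J) Z" and "fin_dim Z"
    and "principalideal (aug_ideal G J) (ring_of (invariants G J))"
    and "f \<in> invariants G J"
    and "aug_ideal G J = Idl\<^bsub>ring_of (invariants G J)\<^esub> {f}"
    and "ext1_dim (sub_group_alg G J) Z Z = 1"
    and "brick (group_alg G) (induced G J Z)"
  shows "\<forall>l\<in>{1..filt_length J}.
      \<not> splits (sub_group_alg G J) (N_filt G J Z l) Z (quot_map G J Z f l)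
    \<and> (\<forall>\<pi>. short_exact (sub_group_alg G J) (N_filt G J Z (l - 1)) (N_filt G J Z l) Z (\<lambda>x. x) \<pi>
           \<longrightarrow> \<not> splits (sub_group_alg G J) (N_filt G J Z l) Z \<pi>)"
proof (intro ballI)
  fix l assume "l \<in> {1..filt_length J}"
  then have l: "l > 0" by simp
  interpret induction_from_subgroup G J Z
    by unfold_locales (fact assms)+
  interpret F: vector_space fscale by (rule vector_space_fscale)
  have J: "ideal J (ring_of UNIV)" and J0: "\<And>a. a \<in> J \<Longrightarrow> counit G a = 0"
    using assms(4) by (simp_all add: normal_subgroup_scheme_def subgroup_scheme_def)
  note eps = counit_in_group_alg[OF G]
  obtain z0 where z0: "z0 \<in> elems Z" "z0 \<noteq> 0"
    by (rule brick_induced_nonzero[OF assms(12)])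
  \<comment> \<open>A section \<open>s\<close> takes its values in \<open>N\<^sub>0 = 1 \<otimes> Z\<close>. If \<open>\<pi>\<close> is constant there, \<open>z = \<pi> (s z)\<close> does
    not depend on \<open>z\<close>, so \<open>Z\<close> has only one element. Constancy, rather than vanishing, is required
    of \<open>\<pi>\<close> since it is evident for \<open>quot_map\<close>, which depends on its argument through \<open>twist\<close> only.\<close>
  have no_section: "\<not> splits (sub_group_alg G J) (N_filt G J Z l) Z \<pi>"
    if const: "\<And>c z. z \<in> elems Z \<Longrightarrow> \<pi> (fscale c (tens D (counit G) z)) = \<pi> 0" for \<pi>
  proof
    assume "splits (sub_group_alg G J) (N_filt G J Z l) Z \<pi>"
    then obtain s where s: "is_hom (sub_group_alg G J) Z (N_filt G J Z l) s"
      "\<And>z. z \<in> elems Z \<Longrightarrow> \<pi> (s z) = z"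
      unfolding splits_def by blast
    obtain c where "\<forall>z\<in>elems Z. s z = fscale c (tens D (counit G) z)"
      by (rule brick_induced_hom[OF assms(12) is_hom_N_filt_induced[OF s(1)]])
    then have "z = \<pi> 0" if "z \<in> elems Z" for z
      using s(2) const that by metis
    from this[OF z0(1)] this[of 0] z0(2) show False
      by (simp add: is_space_closed(1)[OF is_space_Z])
  qed
  have "\<pi> (fscale c (tens D (counit G) z)) = \<pi> 0"
    if ex: "short_exact (sub_group_alg G J) (N_filt G J Z (l - 1)) (N_filt G J Z l) Z (\<lambda>x. x) \<pi>"
      and z: "z \<in> elems Z" for \<pi> c z
  proof -
    have "counit G \<in> H_filt G J (l - 1)"
      using ideal_power_Suc_subset[OF J] J0 eps by (auto simp: H_filt_def)
    then have "tens D (counit G) z \<in> elems (N_filt G J Z (l - 1))"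
      using z by (auto simp: N_filt_def intro!: F.span_base)
    then have "fscale c (tens D (counit G) z) \<in> elems (N_filt G J Z (l - 1))"
      "0 \<in> elems (N_filt G J Z (l - 1))"
      by (simp_all add: N_filt_def F.span_scale F.span_zero)
    then show ?thesis using ex by (auto simp: short_exact_def)
  qed
  moreover have "quot_map G J Z f l (fscale c (tens D (counit G) z)) = quot_map G J Z f l 0"
    if z: "z \<in> elems Z" for c z
  proof -
    have "f \<in> J" using assms(10) by (auto simp: aug_ideal_def genideal_def)
    \<comment> \<open>The counit is multiplicative, vanishes at \<open>f\<close>, and \<open>l\<close> is positive.\<close>
    then have "counit G (y * f ^ l) = 0" for y
      using G J0 l by (cases l) (simp_all add: finite_group_scheme_def)
    then have "twist G J Z f l (tens D (counit G) z) = tens D 0 z"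
      by (simp add: linmap_twist(2)[OF J assms(9) eps z] zero_fun_def)
    also have "\<dots> = 0"
      by (rule linmap_0[OF linmap_tens_ind_data(2)[OF z] is_space_group_alg])
    finally have "twist G J Z f l (fscale c (tens D (counit G) z)) = fscale c 0"
      using linmapD(3)[OF linmap_twist(1)[OF J assms(9)] tens_in_T[OF eps z]] by simp
    moreover have "twist G J Z f l 0 = 0"
      by (rule linmap_0[OF linmap_twist(1)[OF J assms(9)] is_space_tspace])
    ultimately show ?thesis by (simp add: quot_map_def)
  qed
  ultimately show "\<not> splits (sub_group_alg G J) (N_filt G J Z l) Z (quot_map G J Z f l)
    \<and> (\<forall>\<pi>. short_exact (sub_group_alg G J) (N_filt G J Z (l - 1)) (N_filt G J Z l) Z (\<lambda>x. x) \<pi>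
           \<longrightarrow> \<not> splits (sub_group_alg G J) (N_filt G J Z l) Z \<pi>)"
    using no_section by blast
qed

end
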